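(* Let $X=\begin{pmatrix}x&y\\ y&x\end{pmatrix}\in\mathcal{B}^*$. If $X=AB$ with $A,B\in M_2(\mathbb{N}_0)^\bullet$, then $A,B\in\mathcal{B}^*$.
   Context: $M_2(\mathbb{N}_0)^\bullet$ is the semigroup, under matrix multiplication, of $2\times 2$ matrices with non-negative integer entries and non-zero determinant. $\mathcal{B}^*=\left\{\begin{pmatrix}x&y\\ y&x\end{pmatrix}\in M_2(\mathbb{N}_0)^\bullet:\gcd(x,y)=1\right\}$, with the convention $\gcd(n,0)=n$. *)

theory Defs
  imports "HOL-Analysis.Analysis"
begin

text \<open>
  The entries are integers required to lie in \<^term>\<open>\<nat>\<close>, rather than of type \<^typ>\<open>nat\<close>,
  because the library's \<^const>\<open>det\<close> is only defined over commutative rings.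
\<close>

definition M2N0 :: "(int^2^2) set" where
  "M2N0 = {A. (\<forall>i j. A $ i $ j \<in> \<nat>) \<and> det A \<noteq> 0}"

definition Bstar :: "(int^2^2) set" where
  "Bstar = {X \<in> M2N0. \<exists>x y. X = vector [vector [x, y], vector [y, x]] \<and> gcd x y = 1}"

end

theory Submission
  imports Defs
begin

text \<open>
  Let \<open>J\<close> be the matrix that swaps the two coordinates. The matrices of the form
  \<open>((x, y), (y, x)) = x + y J\<close> are exactly those commuting with \<open>J\<close>, so the claim for \<open>A\<close>
  is that the conjugate \<open>N = A\<^sup>-\<^sup>1 J A\<close> equals \<open>J\<close>.

  From \<open>A B = x + y J\<close> and \<open>J A B = y + x J\<close>, conjugation by \<open>A\<close> gives
  \<open>B A = x + y N\<close> and \<open>B J A = y + x N\<close>. Hence \<open>y N\<close> and \<open>x N\<close> are integral, and because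
  \<open>gcd x y = 1\<close> so is \<open>N\<close> (\<open>integral_conjugate_of_swap\<close>).
  The left-hand sides are non-negative. Off the diagonal this says that \<open>N\<close> is non-negative; a
  diagonal entry \<open>m < 0\<close> would force \<open>x \<ge> - y m \<ge> y\<close> and \<open>y \<ge> - x m \<ge> x\<close>, which contradicts
  \<open>x\<^sup>2 - y\<^sup>2 = det X \<noteq> 0\<close> (\<open>conjugate_of_swap_nonneg\<close>). So \<open>N\<close> is a non-negative integral involution,
  and the only such matrices are \<open>1\<close> and \<open>J\<close> (\<open>nonneg_involution_cases\<close>);
  \<open>N = 1\<close> would mean \<open>J A = A\<close>, which makes \<open>A\<close> singular. Therefore \<open>A\<close> commutes with \<open>J\<close>.

  Since \<open>A\<close> and \<open>A B\<close> both commute with \<open>J\<close>, so does \<open>B\<close>, because \<open>A\<close> can be cancelled. Finally, a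
  common divisor of the entries of a factor divides both \<open>x\<close> and \<open>y\<close>.
\<close>

section \<open>Two-by-two matrices and the coordinate swap\<close>

definition swap_mat :: "int^2^2" where
  "swap_mat = vector [vector [0, 1], vector [1, 0]]"

lemma mat2_eq_iff:
  fixes P Q :: "'a^2^2"
  shows "P = Q \<longleftrightarrow> P$1$1 = Q$1$1 \<and> P$1$2 = Q$1$2 \<and> P$2$1 = Q$2$1 \<and> P$2$2 = Q$2$2"
  by (auto simp: vec_eq_iff forall_2)

lemma mat2_mult_nth:
  fixes P Q :: "'a::semiring_1^2^2"
  shows "(P ** Q) $ i $ j = P$i$1 * Q$1$j + P$i$2 * Q$2$j"
  by (simp add: matrix_matrix_mult_def sum_2)

lemma mat2_nth:
  "(mat c :: 'a::zero^2^2)$1$1 = c" "(mat c :: 'a^2^2)$1$2 = 0"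
  "(mat c :: 'a^2^2)$2$1 = 0" "(mat c :: 'a^2^2)$2$2 = c"
  by (simp_all add: mat_def)

lemma swap_mat_nth:
  "swap_mat$1$1 = 0" "swap_mat$1$2 = 1" "swap_mat$2$1 = 1" "swap_mat$2$2 = 0"
  by (simp_all add: swap_mat_def)

lemma swap_mat_involution: "swap_mat ** swap_mat = mat 1"
  by (simp add: mat2_eq_iff mat2_mult_nth mat2_nth swap_mat_nth)

lemma mat_mult_commute:
  fixes P :: "'a::comm_semiring_1^2^2"
  shows "P ** mat c = mat c ** P"
  by (simp add: mat2_eq_iff mat2_mult_nth mat2_nth mult.commute)

lemma mat2_mult_scalar_right:
  fixes P Q :: "'a::comm_semiring_1^2^2"
  shows "P ** (mat c ** Q) = mat c ** (P ** Q)"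
  by (simp add: matrix_mul_assoc mat_mult_commute)

lemma mat2_mult_diff_right:
  fixes P Q R :: "'a::ring_1^2^2"
  shows "P ** (Q - R) = P ** Q - P ** R"
  by (simp add: mat2_eq_iff mat2_mult_nth algebra_simps)

lemma circulant_eq:
  "vector [vector [a, b], vector [b, a]] = mat a + mat b ** swap_mat"
  by (simp add: mat2_eq_iff mat2_mult_nth mat2_nth swap_mat_nth)

lemma commutes_swap_iff:
  "swap_mat ** P = P ** swap_mat \<longleftrightarrow> (\<exists>a b. P = vector [vector [a, b], vector [b, a]])"
  by (auto simp: mat2_eq_iff mat2_mult_nth swap_mat_nth)

text \<open>Multiplying by the adjugate turns the left factor into the scalar \<open>det A\<close>.\<close>

lemma mat2_mult_left_cancel:
  fixes A P Q :: "'a::idom^2^2"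
  assumes "det A \<noteq> 0" and "A ** P = A ** Q"
  shows "P = Q"
proof -
  define C :: "'a^2^2" where "C = vector [vector [A$2$2, - A$1$2], vector [- A$2$1, A$1$1]]"
  have C: "C ** A = mat (det A)"
    by (simp add: C_def mat2_eq_iff mat2_mult_nth mat2_nth det_2 algebra_simps)
  have "mat (det A) ** P = mat (det A) ** Q"
    using assms(2) by (metis C matrix_mul_assoc)
  with assms(1) show ?thesis
    by (simp add: mat2_eq_iff mat2_mult_nth mat2_nth)
qed

section \<open>Conjugating the swap by a left factor\<close>

text \<open>
  With \<open>u x + v y = 1\<close>, the identities \<open>x N = B J A - y\<close> and \<open>y N = B A - x\<close> for \<open>N = A\<^sup>-\<^sup>1 J A\<close>
  exhibit \<open>N\<close> as the integral matrix \<open>u (B J A - y) + v (B A - x)\<close>.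
\<close>

lemma integral_conjugate_of_swap:
  fixes A B :: "int^2^2"
  assumes AB: "A ** B = mat x + mat y ** swap_mat" and gcd: "gcd x y = 1"
  obtains N where "A ** N = swap_mat ** A"
proof -
  obtain u v where uv: "u * x + v * y = 1"
    using bezout_int[of x y] gcd by auto
  define P where "P = B ** swap_mat ** A - mat y"
  define Q where "Q = B ** A - mat x"
  have "A ** P = (A ** B) ** swap_mat ** A - A ** mat y"
    by (simp add: P_def mat2_mult_diff_right matrix_mul_assoc)
  hence P: "A ** P = mat x ** (swap_mat ** A)"
    by (simp add: AB mat2_eq_iff mat2_mult_nth mat2_nth swap_mat_nth)
  have "A ** Q = (A ** B) ** A - A ** mat x"
    by (simp add: Q_def mat2_mult_diff_right matrix_mul_assoc)
  hence Q: "A ** Q = mat y ** (swap_mat ** A)"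
    by (simp add: AB mat2_eq_iff mat2_mult_nth mat2_nth swap_mat_nth algebra_simps)
  have "A ** (mat u ** P + mat v ** Q) = mat u ** (A ** P) + mat v ** (A ** Q)"
    by (simp only: matrix_add_ldistrib mat2_mult_scalar_right)
  also have "\<dots> = mat (u * x + v * y) ** (swap_mat ** A)"
    unfolding P Q by (simp add: mat2_eq_iff mat2_mult_nth mat2_nth algebra_simps)
  finally show ?thesis
    using that uv by simp
qed

text \<open>
  The entries of \<open>x + y N = B A\<close> and \<open>y + x N = B J A\<close> are non-negative. Neither identity suffices
  for the diagonal: only together do they exclude a negative entry there.
\<close>

lemma conjugate_of_swap_nonneg:
  fixes A B N :: "int^2^2"
  assumes AB: "A ** B = mat x + mat y ** swap_mat" and detA: "det A \<noteq> 0"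
    and xy: "x \<ge> 0" "y \<ge> 0" "x \<noteq> y"
    and A: "\<And>i j. A$i$j \<ge> 0" and B: "\<And>i j. B$i$j \<ge> 0"
    and N: "A ** N = swap_mat ** A"
  shows "N$i$j \<ge> 0"
proof -
  have "A ** (B ** A) = A ** (mat x + mat y ** N)"
  proof -
    have "A ** (mat x + mat y ** N) = A ** mat x + mat y ** (A ** N)"
      by (simp only: matrix_add_ldistrib mat2_mult_scalar_right)
    also have "\<dots> = (A ** B) ** A"
      unfolding N AB by (simp add: mat2_eq_iff mat2_mult_nth mat2_nth swap_mat_nth algebra_simps)
    finally show ?thesis by (simp add: matrix_mul_assoc)
  qed
  hence BA: "B ** A = mat x + mat y ** N"
    by (rule mat2_mult_left_cancel[OF detA])
  have "A ** (B ** swap_mat ** A) = A ** (mat y + mat x ** N)"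
  proof -
    have "A ** (mat y + mat x ** N) = A ** mat y + mat x ** (A ** N)"
      by (simp only: matrix_add_ldistrib mat2_mult_scalar_right)
    also have "\<dots> = (A ** B) ** swap_mat ** A"
      unfolding N AB by (simp add: mat2_eq_iff mat2_mult_nth mat2_nth swap_mat_nth algebra_simps)
    finally show ?thesis by (simp add: matrix_mul_assoc)
  qed
  hence BJA: "B ** swap_mat ** A = mat y + mat x ** N"
    by (rule mat2_mult_left_cancel[OF detA])
  have J: "swap_mat$k$l \<ge> 0" for k l
    using exhaust_2[of k] exhaust_2[of l] by (auto simp: swap_mat_nth)
  have 1: "(mat x + mat y ** N)$k$l \<ge> 0" for k l
    unfolding BA[symmetric] by (simp add: mat2_mult_nth A B)
  have 2: "(mat y + mat x ** N)$k$l \<ge> 0" for k l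
    unfolding BJA[symmetric] by (simp add: mat2_mult_nth A B J)
  have off_diagonal: "m \<ge> 0" if "x * m \<ge> 0" "y * m \<ge> 0" for m
    using that xy by (auto simp: zero_le_mult_iff)
  have diagonal: "m \<ge> 0" if *: "x + y * m \<ge> 0" "y + x * m \<ge> 0" for m
  proof (rule ccontr)
    assume "\<not> m \<ge> 0"
    hence "y * m \<le> y * (-1)" "x * m \<le> x * (-1)"
      using xy by (intro mult_left_mono; simp)+
    with * xy(3) show False by linarith
  qed
  have "N$1$1 \<ge> 0" "N$2$2 \<ge> 0"
    using 1[of 1 1] 2[of 1 1] 1[of 2 2] 2[of 2 2]
    by (auto intro!: diagonal simp: mat2_mult_nth mat2_nth)
  moreover have "N$1$2 \<ge> 0" "N$2$1 \<ge> 0"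
    using 1[of 1 2] 2[of 1 2] 1[of 2 1] 2[of 2 1]
    by (auto intro!: off_diagonal simp: mat2_mult_nth mat2_nth)
  ultimately show ?thesis
    using exhaust_2[of i] exhaust_2[of j] by auto
qed

text \<open>
  The off-diagonal entries of \<open>N\<^sup>2\<close> are those of \<open>N\<close> times its trace, and they are \<open>0\<close>. So either
  the trace vanishes, and with it the non-negative diagonal, which leaves two off-diagonal entries
  with product \<open>1\<close>; or \<open>N\<close> is diagonal with entries squaring to \<open>1\<close>.
\<close>

lemma nonneg_involution_cases:
  fixes N :: "int^2^2"
  assumes "N ** N = mat 1" and nonneg: "\<And>i j. N$i$j \<ge> 0"
  shows "N = mat 1 \<or> N = swap_mat"
proof -
  define m n k l where "m = N$1$1" and "n = N$1$2" and "k = N$2$1" and "l = N$2$2"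
  note defs = m_def n_def k_def l_def
  have nn: "m \<ge> 0" "n \<ge> 0" "k \<ge> 0" "l \<ge> 0"
    by (simp_all add: defs nonneg)
  have eqs: "m * m + n * k = 1" "n * (m + l) = 0" "k * (m + l) = 0" "k * n + l * l = 1"
    using assms(1) by (simp_all add: defs mat2_eq_iff mat2_mult_nth mat2_nth algebra_simps)
  have "(m = 1 \<and> n = 0 \<and> k = 0 \<and> l = 1) \<or> (m = 0 \<and> n = 1 \<and> k = 1 \<and> l = 0)"
  proof (cases "m + l = 0")
    case True
    hence "m = 0" "l = 0" using nn by auto
    with eqs(1) nn show ?thesis by (auto simp: zmult_eq_1_iff)
  next
    case False
    hence "n = 0" "k = 0" using eqs by auto
    with eqs(1,4) nn show ?thesis by (auto simp: zmult_eq_1_iff)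
  qed
  thus ?thesis
    by (auto simp: defs mat2_eq_iff mat2_nth swap_mat_nth)
qed

lemma left_factor_commutes_swap:
  fixes A B :: "int^2^2"
  assumes AB: "A ** B = mat x + mat y ** swap_mat" and detA: "det A \<noteq> 0"
    and gcd: "gcd x y = 1" and xy: "x \<ge> 0" "y \<ge> 0" "x \<noteq> y"
    and A: "\<And>i j. A$i$j \<ge> 0" and B: "\<And>i j. B$i$j \<ge> 0"
  shows "swap_mat ** A = A ** swap_mat"
proof -
  obtain N where N: "A ** N = swap_mat ** A"
    using integral_conjugate_of_swap[OF AB gcd] .
  have "A ** (N ** N) = swap_mat ** (swap_mat ** A)"
    by (metis N matrix_mul_assoc)
  also have "\<dots> = A ** mat 1"
    by (simp add: matrix_mul_assoc swap_mat_involution)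
  finally have "N ** N = mat 1"
    by (rule mat2_mult_left_cancel[OF detA])
  moreover have "N$i$j \<ge> 0" for i j
    by (rule conjugate_of_swap_nonneg[OF AB detA xy A B N])
  ultimately consider "N = mat 1" | "N = swap_mat"
    using nonneg_involution_cases by blast
  thus ?thesis
  proof cases
    case 1
    \<comment> \<open>The rows of \<open>A\<close> would be equal.\<close>
    have "A$1$j = A$2$j" for j
    proof -
      have "A$1$j = (swap_mat ** A)$1$j"
        using N 1 by simp
      thus ?thesis
        by (simp add: mat2_mult_nth swap_mat_nth)
    qed
    with detA show ?thesis by (simp add: det_2)
  next
    case 2
    with N show ?thesis by simp
  qed
qed

section \<open>Factorisations of primitive circulant matrices\<close>

theorem theorem5p1:
  fixes x y :: int and X A B :: "int^2^2"
  assumes "X = vector [vector [x, y], vector [y, x]]" and "X \<in> Bstar"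
    and "A \<in> M2N0" and "B \<in> M2N0" and "X = A ** B"
  shows "A \<in> Bstar \<and> B \<in> Bstar"
proof -
  have nth: "X$1$1 = x" "X$1$2 = y" "X$2$1 = y" "X$2$2 = x"
    by (simp_all add: assms(1))
  have AB: "A ** B = mat x + mat y ** swap_mat"
    using assms(1,5) by (simp add: circulant_eq)
  have gcd: "gcd x y = 1"
    using assms(2) nth by (auto simp: Bstar_def)
  have "X$1$1 \<in> \<nat>" "X$1$2 \<in> \<nat>" "det X \<noteq> 0"
    using assms(2) by (auto simp: Bstar_def M2N0_def)
  hence xy: "x \<ge> 0" "y \<ge> 0" "x \<noteq> y"
    by (auto simp: nth det_2 Nats_altdef2)
  have det: "det A \<noteq> 0"
    and A: "\<And>i j. A$i$j \<ge> 0" and B: "\<And>i j. B$i$j \<ge> 0"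
    using assms(3,4) by (auto simp: M2N0_def Nats_altdef2)
  have JA: "swap_mat ** A = A ** swap_mat"
    by (rule left_factor_commutes_swap[OF AB det gcd xy A B])
  have "A ** (swap_mat ** B) = swap_mat ** (A ** B)"
    by (simp only: matrix_mul_assoc JA)
  also have "\<dots> = (A ** B) ** swap_mat"
    unfolding AB using commutes_swap_iff circulant_eq by metis
  also have "\<dots> = A ** (B ** swap_mat)"
    by (simp only: matrix_mul_assoc)
  finally have JB: "swap_mat ** B = B ** swap_mat"
    by (rule mat2_mult_left_cancel[OF det])
  obtain a b where a: "A = vector [vector [a, b], vector [b, a]]"
    using JA by (auto simp: commutes_swap_iff)
  obtain c d where b: "B = vector [vector [c, d], vector [d, c]]"
    using JB by (auto simp: commutes_swap_iff)
  have x: "x = a * c + b * d" and y: "y = a * d + b * c"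
    using nth(1,2) assms(5) by (simp_all add: a b mat2_mult_nth)
  have "gcd a b dvd gcd x y" "gcd c d dvd gcd x y"
    by (simp_all add: x y)
  hence "gcd a b = 1" "gcd c d = 1"
    by (simp_all add: gcd)
  with a b have
    "\<exists>a b. A = vector [vector [a, b], vector [b, a]] \<and> gcd a b = 1"
    "\<exists>c d. B = vector [vector [c, d], vector [d, c]] \<and> gcd c d = 1"
    by metis+
  with assms(3,4) show ?thesis
    by (simp add: Bstar_def)
qed

end
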